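(* Let $I=[0,1]$. Let $a\in(1,\sqrt2)$ be such that $\left(\frac{2a}{1+a}\right)^k$ is not rational for any positive integer $k$, and let $b\in\left(\frac{a}{a+1},\frac1a\right)$ be a rational number. Let $H$ be the closed relation on $I$ defined by $$H=\Big\{(x,y)\in\big[0,\tfrac1a\big]\times[0,1] : y=\tfrac{2a}{a+1}x+\tfrac{a-1}{a+1}\Big\}\cup\Big\{(x,y)\in[0,1]\times[0,b] : y=\tfrac{b+1}{2}x+\tfrac{b-1}{2}\Big\}.$$ Then 1. $H$ is the graph of a surjective upper semicontinuous set-valued function from $I$ to $I$; 2. $H$ is i-embedded into $I\times I$; that is, $\mathrm{ent}(H)>0$ and no periodic point is generated by $H$.
   Context: For compact metric spaces $X,Y$, $2^Y$ is the set of nonempty closed subsets of $Y$; a set-valued function from $X$ to $Y$ is a function $F:X\to 2^Y$, with graph $\Gamma(F)=\{(x,y)\in X\times Y : y\in F(x)\}$; it is surjective if $\bigcup_{x\in X}F(x)=Y$. $F$ is upper semicontinuous if for each $x_0\in X$ and each open $U\subseteq Y$ with $F(x_0)\subseteq U$ there is an open $V\ni x_0$ with $F(x)\subseteq U$ for all $x\in V$. A closed relation on a compact metric space $X$ is a closed subset $G\subseteq X\times X$. For a positive integer $m$, $\star_{i=1}^{m}G^{-1}=\{(x_1,\dots,x_{m+1})\in X^{m+1} : (x_{i+1},x_i)\in G \text{ for } i=1,\dots,m\}$, and $\star_{i=1}^{\infty}G^{-1}=\{(x_1,x_2,\dots)\in\prod_{i=1}^\infty X : (x_{i+1},x_i)\in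 G\text{ for all }i\ge1\}$. The shift map $\sigma$ on $\star_{i=1}^{\infty}G^{-1}$ is $\sigma(x_1,x_2,x_3,\dots)=(x_2,x_3,\dots)$. A periodic point generated by $G$ is a point $\mathbf x\in\star_{i=1}^{\infty}G^{-1}$ with $\sigma^n(\mathbf x)=\mathbf x$ for some positive integer $n$; no periodic point is generated by $G$ if there is no such $\mathbf x$. For an open cover $\alpha$ of $X$, $\alpha^{n}=\{A_1\times\dots\times A_n : A_j\in\alpha\}$, and for closed $K\subseteq X^n$, $N(K,\alpha^n)$ is the minimal cardinality of a subfamily of $\alpha^n$ whose union contains $K$. For $G\ne\emptyset$, $\mathrm{ent}(G,\alpha)=\lim_{m\to\infty}\frac{1}{m}\log N(\star_{i=1}^mG^{-1},\alpha^{m+1})$ (convention: $\log 0:=0$, relevant only if a Mahavier product is empty; the limit exists). The entropy is $\mathrm{ent}(G)=\sup_\alpha\mathrm{ent}(G,\alpha)\in[0,\infty]$ over all open covers $\alpha$ of $X$ if $G\neq\emptyset$, and $\mathrm{ent}(\emptyset)=0$. $G$ is i-embedded (irrationally embedded) into $X\times X$ if $\mathrm{ent}(G)>0$ and no periodic point is generated by $G$. *)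

theory Defs
  imports "HOL-Analysis.Analysis"
begin

text \<open>Spaces are carrier sets \<open>X\<close> in a metric-space type, with the subspace topology.\<close>

definition nonempty_closed_subsets :: "'b::metric_space set \<Rightarrow> 'b set set" where
  "nonempty_closed_subsets Y = {A. A \<noteq> {} \<and> closedin (top_of_set Y) A}"

text \<open>Values of a set-valued function outside its domain \<open>X\<close> are irrelevant.\<close>

definition set_valued_function ::
  "'a::metric_space set \<Rightarrow> 'b::metric_space set \<Rightarrow> ('a \<Rightarrow> 'b set) \<Rightarrow> bool" where
  "set_valued_function X Y F \<longleftrightarrow> F \<in> X \<rightarrow> nonempty_closed_subsets Y"

definition svf_graph :: "'a set \<Rightarrow> 'b set \<Rightarrow> ('a \<Rightarrow> 'b set) \<Rightarrow> ('a \<times> 'b) set" where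
  "svf_graph X Y F = {(x, y) \<in> X \<times> Y. y \<in> F x}"

definition svf_surjective :: "'a set \<Rightarrow> 'b set \<Rightarrow> ('a \<Rightarrow> 'b set) \<Rightarrow> bool" where
  "svf_surjective X Y F \<longleftrightarrow> (\<Union>x\<in>X. F x) = Y"

definition upper_semicontinuous ::
  "'a::metric_space set \<Rightarrow> 'b::metric_space set \<Rightarrow> ('a \<Rightarrow> 'b set) \<Rightarrow> bool" where
  "upper_semicontinuous X Y F \<longleftrightarrow>
     (\<forall>x0\<in>X. \<forall>U. openin (top_of_set Y) U \<and> F x0 \<subseteq> U \<longrightarrow>
        (\<exists>V. openin (top_of_set X) V \<and> x0 \<in> V \<and> (\<forall>x\<in>V. F x \<subseteq> U)))"

definition closed_relation :: "'a::metric_space set \<Rightarrow> ('a \<times> 'a) set \<Rightarrow> bool" where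
  "closed_relation X G \<longleftrightarrow> closedin (top_of_set (X \<times> X)) G"

text \<open>Coordinates are numbered from 0: points of \<open>X\<^sup>n\<close> are the extensional functions
  in \<open>{..<n} \<rightarrow>\<^sub>E X\<close>, and infinite sequences are functions on \<open>nat\<close>.\<close>

definition mahavier :: "'a set \<Rightarrow> ('a \<times> 'a) set \<Rightarrow> nat \<Rightarrow> (nat \<Rightarrow> 'a) set" where
  "mahavier X G m = {x \<in> {..<m+1} \<rightarrow>\<^sub>E X. \<forall>i<m. (x (Suc i), x i) \<in> G}"

definition mahavier_inf :: "'a set \<Rightarrow> ('a \<times> 'a) set \<Rightarrow> (nat \<Rightarrow> 'a) set" where
  "mahavier_inf X G = {x \<in> UNIV \<rightarrow> X. \<forall>i. (x (Suc i), x i) \<in> G}"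

definition shift_map :: "(nat \<Rightarrow> 'a) \<Rightarrow> (nat \<Rightarrow> 'a)" where
  "shift_map x = (\<lambda>i. x (Suc i))"

definition periodic_point_generated :: "'a set \<Rightarrow> ('a \<times> 'a) set \<Rightarrow> (nat \<Rightarrow> 'a) \<Rightarrow> bool" where
  "periodic_point_generated X G x \<longleftrightarrow>
     x \<in> mahavier_inf X G \<and> (\<exists>n>0. (shift_map ^^ n) x = x)"

definition open_cover :: "'a::metric_space set \<Rightarrow> 'a set set \<Rightarrow> bool" where
  "open_cover X \<alpha> \<longleftrightarrow> (\<forall>A\<in>\<alpha>. openin (top_of_set X) A) \<and> \<Union>\<alpha> = X"

definition cover_power :: "'a set set \<Rightarrow> nat \<Rightarrow> (nat \<Rightarrow> 'a) set set" where
  "cover_power \<alpha> n = {Pi\<^sub>E {..<n} A | A. A \<in> {..<n} \<rightarrow> \<alpha>}"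

text \<open>Only finite subfamilies are considered; by compactness one exists for closed
  \<open>K \<subseteq> X\<^sup>n\<close> and an open cover of the compact space \<open>X\<close>, so this is the minimal cardinality.
  Finiteness is needed since \<open>card\<close> of an infinite set is 0.\<close>

definition cover_number :: "(nat \<Rightarrow> 'a) set \<Rightarrow> (nat \<Rightarrow> 'a) set set \<Rightarrow> nat" where
  "cover_number K \<C> = (LEAST n. \<exists>\<B>. \<B> \<subseteq> \<C> \<and> finite \<B> \<and> card \<B> = n \<and> K \<subseteq> \<Union>\<B>)"

text \<open>The convention \<open>log 0 = 0\<close> is the library's \<open>ln 0 = 0\<close>. The term at \<open>m = 0\<close> does not
  affect the limit.\<close>

definition entropy_cover :: "'a set \<Rightarrow> ('a \<times> 'a) set \<Rightarrow> 'a set set \<Rightarrow> real" where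
  "entropy_cover X G \<alpha> =
     lim (\<lambda>m. 1 / real m * ln (real (cover_number (mahavier X G m) (cover_power \<alpha> (m+1)))))"

definition relation_entropy :: "'a::metric_space set \<Rightarrow> ('a \<times> 'a) set \<Rightarrow> ereal" where
  "relation_entropy X G =
     (if G = {} then 0 else (SUP \<alpha>\<in>{\<alpha>. open_cover X \<alpha>}. ereal (entropy_cover X G \<alpha>)))"

definition i_embedded :: "'a::metric_space set \<Rightarrow> ('a \<times> 'a) set \<Rightarrow> bool" where
  "i_embedded X G \<longleftrightarrow>
     closed_relation X G \<and> relation_entropy X G > 0 \<and> (\<nexists>x. periodic_point_generated X G x)"

end

theory Submission
  imports Defs
begin

text \<open>
  Both lines that make up \<open>H\<close> pass through \<open>(-1, -1)\<close>. In the coordinate \<open>1 + x\<close>, which runs over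
  \<open>[1, 2]\<close>, they are the multiplications by \<open>s = 2a/(a+1) > 1\<close> and \<open>t = (b+1)/2 < 1\<close>, each applied
  whenever the result stays in \<open>[1, 2]\<close>. Everything about \<open>H\<close> is read off from this description
  (\<open>scaling_relation s t\<close>) and from the inequalities \<open>s t < 1\<close>, which is \<open>b < 1/a\<close>, and
  \<open>s < 2 t\<^sup>2\<close>, which follows from \<open>b > a/(a+1)\<close>.

  A periodic point would give \<open>s\<^sup>i t\<^sup>j = 1\<close> with \<open>i + j > 0\<close>. As \<open>t\<close> is rational and no positive
  power of \<open>s\<close> is, this forces \<open>i = 0\<close>, and then \<open>t < 1\<close> is contradicted
  (\<open>scaling_relation_no_periodic_point\<close>).

  The entropy is positive because orbits branch at a positive rate. Where
  \<open>1/t \<le> 1 + x \<le> 2/s\<close> both multiplications are available. A point above this window falls into it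
  after one multiplication by \<open>t\<close>. A point below it is pushed up by \<open>s\<close> and cannot jump over the
  window, since \<open>s/t \<le> 2/s\<close>. So every orbit can branch again within a fixed number \<open>K\<close> of steps, and
  there are at least \<open>2\<^sup>m\<close> orbits of length \<open>m K\<close> from each point (\<open>orbits_double\<close>). Two orbits with
  the same start first differ right after a branching, and there their distance is at least \<open>s - t\<close>.
  Hence no box of a cover of mesh less than \<open>s - t\<close> contains two of them, and the entropy with
  respect to such a cover is at least \<open>ln 2 / K\<close> (\<open>relation_entropy_pos_if_branching\<close>). For
  this estimate the limit that defines the entropy has to exist; it does by Fekete's lemma, since
  covering numbers of Mahavier products are submultiplicative (\<open>entropy_cover_LIMSEQ\<close>).
\<close>

section \<open>Subadditive sequences\<close>

text \<open>
  Fekete's lemma. Cutting \<open>n\<close> into blocks of a length \<open>N\<close> with almost optimal \<open>u N / N\<close> bounds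
  \<open>u n / n\<close> by \<open>u N / N\<close> plus the contribution of one short remainder, which dies out after division
  by \<open>n\<close>. So the limit is the infimum.
\<close>

lemma subadditive_nonneg_convergent:
  fixes u :: "nat \<Rightarrow> real"
  assumes nonneg: "\<And>n. 0 \<le> u n" and sub: "\<And>m n. u (m + n) \<le> u m + u n"
  shows "convergent (\<lambda>n. u n / real n)"
proof -
  define L where "L = (INF n\<in>{1..}. u n / real n)"
  have bdd: "bdd_below ((\<lambda>n. u n / real n) ` {1..})"
    by (rule bdd_belowI2[where m = 0]) (simp add: nonneg)
  have blocks: "u (q * N + r) \<le> real q * u N + u r" for q N r
  proof (induction q)
    case (Suc q)
    have "u (Suc q * N + r) = u (N + (q * N + r))" by (simp add: algebra_simps)
    also have "\<dots> \<le> u N + (real q * u N + u r)"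
      using sub[of N "q * N + r"] Suc.IH by linarith
    finally show ?case by (simp add: algebra_simps)
  qed simp
  have "(\<lambda>n. u n / real n) \<longlonglongrightarrow> L"
  proof (rule LIMSEQ_I)
    fix e :: real assume e: "0 < e"
    have "(INF n\<in>{1..}. u n / real n) < L + e / 2" using e by (simp add: L_def)
    then obtain N where N: "N \<ge> 1" "u N / real N < L + e / 2"
      using cINF_less_iff[OF _ bdd] by (metis atLeast_iff empty_iff order_refl)
    define M where "M = (\<Sum>r<N. u r)"
    have M0: "0 \<le> M" unfolding M_def by (simp add: sum_nonneg nonneg)
    obtain n0 where n0: "2 * M / e < real n0" using reals_Archimedean2 by blast
    have "norm (u n / real n - L) < e" if n: "n \<ge> max 1 n0" for n
    proof -
      have npos: "0 < real n" using n by simp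
      have "L \<le> u n / real n"
        unfolding L_def by (rule cINF_lower[OF bdd]) (use n in simp)
      moreover have "u n / real n < L + e"
      proof -
        have "n mod N < N" using N by simp
        hence rem: "u (n mod N) \<le> M"
          unfolding M_def by (intro member_le_sum) (auto simp: nonneg)
        have "real (n div N) * real N \<le> real n"
          by (metis div_times_less_eq_dividend of_nat_le_iff of_nat_mult)
        hence quot: "real (n div N) * real N * (u N / real N) \<le> real n * (u N / real N)"
          by (rule mult_right_mono) (simp add: nonneg)
        have "u n \<le> real (n div N) * u N + u (n mod N)"
          using blocks[of "n div N" N "n mod N"] by simp
        also have "\<dots> \<le> real n * (u N / real N) + M"
          using quot rem N by simp
        finally have "u n / real n \<le> u N / real N + M / real n"
          using npos by (simp add: field_simps)
        moreover have "M / real n < e / 2"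
        proof -
          have "2 * M / e < real n" using n0 n by simp
          thus ?thesis using e npos by (simp add: field_simps)
        qed
        ultimately show ?thesis using N by linarith
      qed
      ultimately show ?thesis by simp
    qed
    thus "\<exists>no. \<forall>n\<ge>no. norm (u n / real n - L) < e" by blast
  qed
  thus ?thesis by (rule convergentI)
qed

section \<open>Covering numbers of Mahavier products\<close>

lemma cover_number_le:
  assumes "\<B> \<subseteq> \<C>" "finite \<B>" "K \<subseteq> \<Union>\<B>"
  shows "cover_number K \<C> \<le> card \<B>"
  unfolding cover_number_def using assms by (intro Least_le) blast

lemma cover_number_attained:
  assumes "\<B> \<subseteq> \<C>" "finite \<B>" "K \<subseteq> \<Union>\<B>"
  obtains \<D> where "\<D> \<subseteq> \<C>" "finite \<D>" "card \<D> = cover_number K \<C>" "K \<subseteq> \<Union>\<D>"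
proof -
  have "\<exists>\<D>. \<D> \<subseteq> \<C> \<and> finite \<D> \<and> card \<D> = cover_number K \<C> \<and> K \<subseteq> \<Union>\<D>"
    unfolding cover_number_def
    by (rule LeastI_ex) (use assms in blast)
  thus ?thesis using that by blast
qed

text \<open>
  The lower bound for covering numbers: a covering family needs a different member for each
  point of a set no two of whose points share a member.
\<close>

lemma card_separated_le_cover_number:
  assumes "finite \<C>" "K \<subseteq> \<Union>\<C>"
    and into: "f ` S \<subseteq> K"
    and sep: "\<And>x y C. x \<in> S \<Longrightarrow> y \<in> S \<Longrightarrow> C \<in> \<C> \<Longrightarrow> f x \<in> C \<Longrightarrow> f y \<in> C \<Longrightarrow> x = y"
  shows "card S \<le> cover_number K \<C>"
proof -
  obtain \<D> where D: "\<D> \<subseteq> \<C>" "finite \<D>" "card \<D> = cover_number K \<C>" "K \<subseteq> \<Union>\<D>"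
    using cover_number_attained[OF order_refl assms(1,2)] by blast
  have "\<forall>x\<in>S. \<exists>C\<in>\<D>. f x \<in> C" using into D(4) by blast
  then obtain h where h: "\<And>x. x \<in> S \<Longrightarrow> h x \<in> \<D> \<and> f x \<in> h x" by metis
  have "inj_on h S"
    by (rule inj_onI) (metis h D(1) sep subsetD)
  hence "card S \<le> card \<D>" using h D(2) by (intro card_inj_on_le) auto
  thus ?thesis using D(3) by simp
qed

lemma finite_cover_power: "finite \<alpha> \<Longrightarrow> finite (cover_power \<alpha> n)"
proof -
  assume "finite \<alpha>"
  have "cover_power \<alpha> n \<subseteq> Pi\<^sub>E {..<n} ` ({..<n} \<rightarrow>\<^sub>E \<alpha>)"
  proof
    fix B assume "B \<in> cover_power \<alpha> n"
    then obtain A where A: "A \<in> {..<n} \<rightarrow> \<alpha>" "B = Pi\<^sub>E {..<n} A"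
      unfolding cover_power_def by blast
    have "B = Pi\<^sub>E {..<n} (restrict A {..<n})" unfolding A(2) by (rule PiE_cong) simp
    moreover have "restrict A {..<n} \<in> {..<n} \<rightarrow>\<^sub>E \<alpha>" using A(1) by auto
    ultimately show "B \<in> Pi\<^sub>E {..<n} ` ({..<n} \<rightarrow>\<^sub>E \<alpha>)" by blast
  qed
  moreover have "finite ({..<n} \<rightarrow>\<^sub>E \<alpha>)" using \<open>finite \<alpha>\<close> by (intro finite_PiE) auto
  ultimately show ?thesis using finite_surj by blast
qed

lemma mahavier_subset_cover_power:
  assumes "X \<subseteq> \<Union>\<alpha>"
  shows "mahavier X G m \<subseteq> \<Union>(cover_power \<alpha> (m + 1))"
proof
  fix x assume x: "x \<in> mahavier X G m"
  hence xE: "x \<in> {..<m+1} \<rightarrow>\<^sub>E X" unfolding mahavier_def by blast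
  hence "\<forall>i\<in>{..<m+1}. \<exists>A\<in>\<alpha>. x i \<in> A" using assms by blast
  then obtain A where A: "\<And>i. i \<in> {..<m+1} \<Longrightarrow> A i \<in> \<alpha> \<and> x i \<in> A i" by metis
  have "x \<in> Pi\<^sub>E {..<m+1} A" using A xE by (auto simp: PiE_iff)
  moreover have "Pi\<^sub>E {..<m+1} A \<in> cover_power \<alpha> (m + 1)"
    unfolding cover_power_def using A by blast
  ultimately show "x \<in> \<Union>(cover_power \<alpha> (m + 1))" by blast
qed

text \<open>
  A sequence of \<open>m + n + 2\<close> points splits into its first \<open>m + 1\<close> and its last \<open>n + 1\<close> points, both
  sequences of the same kind. The products of the boxes of an optimal cover for the first part with
  those for the second therefore cover. The step that joins the two parts is the extra one in
  \<open>m + n + 1\<close>.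
\<close>

lemma cover_number_mahavier_submult:
  assumes fin: "finite \<alpha>" and cov: "X \<subseteq> \<Union>\<alpha>"
  shows "cover_number (mahavier X G (m + n + 1)) (cover_power \<alpha> (m + n + 2))
    \<le> cover_number (mahavier X G m) (cover_power \<alpha> (m + 1)) *
      cover_number (mahavier X G n) (cover_power \<alpha> (n + 1))"
proof -
  have opt: "\<exists>\<D>. \<D> \<subseteq> cover_power \<alpha> (k + 1) \<and> finite \<D> \<and>
      card \<D> = cover_number (mahavier X G k) (cover_power \<alpha> (k + 1)) \<and>
      mahavier X G k \<subseteq> \<Union>\<D>" for k
    using cover_number_attained[OF order_refl finite_cover_power[OF fin]
        mahavier_subset_cover_power[OF cov]] by metis
  obtain \<D> where D: "\<D> \<subseteq> cover_power \<alpha> (m + 1)" "finite \<D>"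
    "card \<D> = cover_number (mahavier X G m) (cover_power \<alpha> (m + 1))" "mahavier X G m \<subseteq> \<Union>\<D>"
    using opt[of m] by (elim exE conjE)
  obtain \<E> where E: "\<E> \<subseteq> cover_power \<alpha> (n + 1)" "finite \<E>"
    "card \<E> = cover_number (mahavier X G n) (cover_power \<alpha> (n + 1))" "mahavier X G n \<subseteq> \<Union>\<E>"
    using opt[of n] by (elim exE conjE)
  define init where "init x = restrict x {..<m+1}" for x :: "nat \<Rightarrow> 'a"
  define tail where "tail x = (\<lambda>i\<in>{..<n+1}. x (m + 1 + i))" for x :: "nat \<Rightarrow> 'a"
  define join where
    "join D E = {x \<in> extensional {..<m+n+2}. init x \<in> D \<and> tail x \<in> E}" for D E
  have join: "join D E \<in> cover_power \<alpha> (m + n + 2)" if DE: "D \<in> \<D>" "E \<in> \<E>" for D E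
  proof -
    obtain A where A: "A \<in> {..<m+1} \<rightarrow> \<alpha>" "D = Pi\<^sub>E {..<m+1} A"
      using D(1) DE unfolding cover_power_def by blast
    obtain B where B: "B \<in> {..<n+1} \<rightarrow> \<alpha>" "E = Pi\<^sub>E {..<n+1} B"
      using E(1) DE unfolding cover_power_def by blast
    define C where "C i = (if i < m + 1 then A i else B (i - (m + 1)))" for i
    have CA: "C i = A i" if "i < m + 1" for i using that by (simp add: C_def)
    have CB: "C (m + 1 + i) = B i" for i by (simp add: C_def)
    have split: "(\<forall>i<m+n+2. P i) \<longleftrightarrow> (\<forall>i<m+1. P i) \<and> (\<forall>i<n+1. P (m + 1 + i))" for P
    proof safe
      fix i assume h: "\<forall>i<m + 1. P i" "\<forall>i<n + 1. P (m + 1 + i)" "i < m + n + 2"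
      show "P i"
      proof (cases "i < m + 1")
        case False
        hence "i = m + 1 + (i - (m + 1))" "i - (m + 1) < n + 1" using h(3) by auto
        thus ?thesis using h(2) by metis
      qed (use h in auto)
    qed auto
    have "C \<in> {..<m+n+2} \<rightarrow> \<alpha>"
      unfolding Pi_iff Ball_def lessThan_iff split CB using A(1) B(1) CA by auto
    moreover have "join D E = Pi\<^sub>E {..<m+n+2} C"
    proof (intro set_eqI)
      fix x
      have "init x \<in> D \<longleftrightarrow> (\<forall>i<m+1. x i \<in> C i)"
        unfolding A(2) init_def using CA by (auto simp: PiE_iff)
      moreover have "tail x \<in> E \<longleftrightarrow> (\<forall>i<n+1. x (m + 1 + i) \<in> C (m + 1 + i))"
        unfolding B(2) tail_def CB by (auto simp: PiE_iff)
      moreover have "x \<in> Pi\<^sub>E {..<m+n+2} C \<longleftrightarrow>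
          x \<in> extensional {..<m+n+2} \<and> (\<forall>i<m+n+2. x i \<in> C i)"
        by (auto simp: PiE_iff)
      ultimately show "x \<in> join D E \<longleftrightarrow> x \<in> Pi\<^sub>E {..<m+n+2} C"
        unfolding join_def split by auto
    qed
    ultimately show ?thesis unfolding cover_power_def by blast
  qed
  define \<F> where "\<F> = (\<lambda>(D, E). join D E) ` (\<D> \<times> \<E>)"
  have "mahavier X G (m + n + 1) \<subseteq> \<Union>\<F>"
  proof
    fix x assume x: "x \<in> mahavier X G (m + n + 1)"
    have "init x \<in> mahavier X G m" "tail x \<in> mahavier X G n"
      using x unfolding mahavier_def init_def tail_def by (auto simp: PiE_iff)
    then obtain D E where "D \<in> \<D>" "E \<in> \<E>" "init x \<in> D" "tail x \<in> E"
      using D(4) E(4) by blast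
    moreover have "x \<in> extensional {..<m+n+2}"
      using x unfolding mahavier_def by (auto simp: PiE_iff)
    ultimately show "x \<in> \<Union>\<F>" unfolding \<F>_def join_def by force
  qed
  moreover have "\<F> \<subseteq> cover_power \<alpha> (m + n + 2)" unfolding \<F>_def using join by auto
  moreover have "finite \<F>" unfolding \<F>_def using D E by auto
  ultimately have "cover_number (mahavier X G (m + n + 1)) (cover_power \<alpha> (m + n + 2)) \<le> card \<F>"
    by (intro cover_number_le)
  also have "\<dots> \<le> card (\<D> \<times> \<E>)" unfolding \<F>_def using D E by (intro card_image_le) auto
  finally show ?thesis using D(3) E(3) by (simp add: card_cartesian_product)
qed

text \<open>
  Submultiplicativity makes the limit in the definition of the entropy exist, so that it can be
  computed along any subsequence.
\<close>

lemma entropy_cover_LIMSEQ: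
  assumes fin: "finite \<alpha>" and cov: "X \<subseteq> \<Union>\<alpha>"
  shows "(\<lambda>m. 1 / real m * ln (real (cover_number (mahavier X G m) (cover_power \<alpha> (m+1)))))
    \<longlonglongrightarrow> entropy_cover X G \<alpha>"
proof -
  define N where "N m = cover_number (mahavier X G m) (cover_power \<alpha> (m+1))" for m
  \<comment> \<open>Indexing by the number of points instead of the number of steps makes the logarithms
    subadditive; the value at 0 makes this hold without exception.\<close>
  define u where "u k = (case k of 0 \<Rightarrow> 0 | Suc m \<Rightarrow> ln (real (N m)))" for k
  have ln0: "0 \<le> ln (real k)" for k :: nat by (cases k) auto
  have "convergent (\<lambda>n. u n / real n)"
  proof (rule subadditive_nonneg_convergent)
    show "0 \<le> u n" for n unfolding u_def using ln0 by (cases n) auto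
    show "u (m + n) \<le> u m + u n" for m n
    proof (cases m)
      case 0 thus ?thesis by (simp add: u_def)
    next
      case m: (Suc m')
      show ?thesis
      proof (cases n)
        case 0 thus ?thesis by (simp add: u_def)
      next
        case n: (Suc n')
        have le: "N (m' + n' + 1) \<le> N m' * N n'"
          using cover_number_mahavier_submult[OF fin cov, of G m' n']
          by (simp add: N_def)
        have "ln (real (N (m' + n' + 1))) \<le> ln (real (N m')) + ln (real (N n'))"
        proof (cases "N (m' + n' + 1) = 0")
          case True thus ?thesis using ln0 by simp
        next
          case False
          hence pos: "0 < N m'" "0 < N n'" using le by (auto intro: gr0I)
          have "ln (real (N (m' + n' + 1))) \<le> ln (real (N m') * real (N n'))"
            using le False pos by (subst ln_le_cancel_iff) (auto simp flip: of_nat_mult)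
          thus ?thesis using pos by (simp add: ln_mult)
        qed
        thus ?thesis by (simp add: u_def m n)
      qed
    qed
  qed
  then obtain L where "(\<lambda>n. u n / real n) \<longlonglongrightarrow> L" by (auto simp: convergent_def)
  hence "(\<lambda>n. u (Suc n) / real (Suc n)) \<longlonglongrightarrow> L" by (rule LIMSEQ_Suc)
  hence "(\<lambda>n. u (Suc n) / real (Suc n) * (real (Suc n) / real n)) \<longlonglongrightarrow> L * 1"
    by (rule tendsto_mult) (rule LIMSEQ_Suc_n_over_n)
  hence "(\<lambda>m. 1 / real m * ln (real (N m))) \<longlonglongrightarrow> L"
    by (simp add: u_def del: of_nat_Suc)
  hence "convergent (\<lambda>m. 1 / real m * ln (real (N m)))" by (rule convergentI)
  thus ?thesis unfolding entropy_cover_def N_def by (simp add: convergent_LIMSEQ_iff)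
qed

section \<open>Entropy from branching\<close>

text \<open>Finite forward orbits of \<open>n\<close> steps, unfolded from the front, so that their number can be
  bounded by recursion on \<open>n\<close>.\<close>

primrec orbits :: "('a \<times> 'a) set \<Rightarrow> nat \<Rightarrow> 'a \<Rightarrow> 'a list set" where
  "orbits G 0 x = {[x]}"
| "orbits G (Suc n) x = (\<Union>y\<in>G `` {x}. (#) x ` orbits G n y)"

lemma orbits_nth_0: "xs \<in> orbits G n x \<Longrightarrow> xs ! 0 = x"
  by (cases n) auto

lemma orbits_step: "xs \<in> orbits G n x \<Longrightarrow> i < n \<Longrightarrow> (xs ! i, xs ! Suc i) \<in> G"
proof (induction n arbitrary: x xs i)
  case (Suc n)
  then obtain y ys where y: "(x, y) \<in> G" "ys \<in> orbits G n y" "xs = x # ys" by auto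
  show ?case
  proof (cases i)
    case 0
    thus ?thesis using y orbits_nth_0[OF y(2)] by simp
  next
    case i: (Suc j)
    thus ?thesis using Suc.IH[OF y(2), of j] Suc.prems(2) y(3) by simp
  qed
qed simp

lemma finite_orbits:
  assumes "\<And>x. finite (G `` {x})"
  shows "finite (orbits G n x)"
  by (induction n arbitrary: x) (use assms in auto)

lemma card_orbits_Suc:
  assumes "\<And>x. finite (G `` {x})"
  shows "card (orbits G (Suc n) x) = (\<Sum>y\<in>G `` {x}. card (orbits G n y))"
proof -
  have "card (\<Union>y\<in>G `` {x}. (#) x ` orbits G n y) = (\<Sum>y\<in>G `` {x}. card ((#) x ` orbits G n y))"
  proof (rule card_UN_disjoint)
    show "\<forall>y\<in>G `` {x}. \<forall>z\<in>G `` {x}. y \<noteq> z \<longrightarrow>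
        (#) x ` orbits G n y \<inter> (#) x ` orbits G n z = {}"
      by (auto dest!: orbits_nth_0)
  qed (simp_all add: assms finite_orbits)
  thus ?thesis by (simp add: card_image)
qed

text \<open>
  Different orbits with a common start have a last common point before they first differ, and
  distinct successors of that point are \<open>\<delta>\<close> apart.
\<close>

lemma orbits_eq_if_close:
  fixes G :: "('a::metric_space \<times> 'a) set"
  assumes branch: "\<And>x y z. (x, y) \<in> G \<Longrightarrow> (x, z) \<in> G \<Longrightarrow> y \<noteq> z \<Longrightarrow> \<delta> \<le> dist y z"
  shows "xs \<in> orbits G n x \<Longrightarrow> ys \<in> orbits G n x \<Longrightarrow>
    (\<And>i. i \<le> n \<Longrightarrow> dist (xs ! i) (ys ! i) < \<delta>) \<Longrightarrow> xs = ys"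
proof (induction n arbitrary: x xs ys)
  case (Suc n)
  obtain y xs' where y: "(x, y) \<in> G" "xs' \<in> orbits G n y" "xs = x # xs'" using Suc.prems by auto
  obtain z ys' where z: "(x, z) \<in> G" "ys' \<in> orbits G n z" "ys = x # ys'" using Suc.prems by auto
  have close: "dist (xs' ! i) (ys' ! i) < \<delta>" if "i \<le> n" for i
    using Suc.prems(3)[of "Suc i"] that y z by simp
  have "y = z"
    using branch[OF y(1) z(1)] close[of 0] orbits_nth_0[OF y(2)] orbits_nth_0[OF z(2)] by force
  thus ?case using Suc.IH y z close by blast
qed simp

text \<open>
  Cover \<open>X\<close> by finitely many balls of radius \<open>\<delta> / 2\<close>. A product of such balls contains at most one
  orbit from \<open>x\<close>, so at least \<open>2\<^sup>m\<close> boxes are needed for \<open>m K\<close> steps, and along the multiples of \<open>K\<close> the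
  averages in the definition of the entropy stay above \<open>ln 2 / K\<close>.
\<close>

lemma relation_entropy_pos_if_branching:
  fixes X :: "'a::metric_space set"
  assumes X: "compact X" and G: "G \<subseteq> X \<times> X" and x: "x \<in> X"
    and delta: "0 < \<delta>"
    and branch: "\<And>x y z. (x, y) \<in> G \<Longrightarrow> (x, z) \<in> G \<Longrightarrow> y \<noteq> z \<Longrightarrow> \<delta> \<le> dist y z"
    and K: "0 < K" and growth: "\<And>m. 2 ^ m \<le> card (orbits G (m * K) x)"
  shows "0 < relation_entropy X G"
proof -
  obtain F where F: "finite F" "F \<subseteq> X" "X \<subseteq> (\<Union>c\<in>F. ball c (\<delta> / 2))"
    using compactE_image[OF X, of X "\<lambda>c. ball c (\<delta> / 2)"] delta by force
  define \<alpha> where "\<alpha> = (\<lambda>c. X \<inter> ball c (\<delta> / 2)) ` F"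
  have fin: "finite \<alpha>" and cov: "\<Union>\<alpha> = X" unfolding \<alpha>_def using F by auto
  have "open_cover X \<alpha>"
    unfolding open_cover_def using cov by (auto simp: \<alpha>_def intro: openin_open_Int)
  have small: "dist p q < \<delta>" if "A \<in> \<alpha>" "p \<in> A" "q \<in> A" for A p q
    using that dist_triangle_half_r unfolding \<alpha>_def by fastforce
  define N where "N m = cover_number (mahavier X G m) (cover_power \<alpha> (m+1))" for m
  have orbit_in_X: "xs ! i \<in> X" if "xs \<in> orbits G n x" "i \<le> n" for xs n i
  proof (cases i)
    case 0 thus ?thesis using x orbits_nth_0[OF that(1)] by simp
  next
    case (Suc j) thus ?thesis using orbits_step[OF that(1), of j] that(2) G by auto
  qed
  have N: "card (orbits G n x) \<le> N n" for n
  proof -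
    \<comment> \<open>Points of a Mahavier product are orbits read backwards.\<close>
    define f where "f xs = (\<lambda>i\<in>{..<n+1}. xs ! (n - i))" for xs :: "'a list"
    show ?thesis unfolding N_def
    proof (rule card_separated_le_cover_number[where f = f])
      show "finite (cover_power \<alpha> (n + 1))" using fin by (rule finite_cover_power)
      show "mahavier X G n \<subseteq> \<Union>(cover_power \<alpha> (n + 1))"
        using cov by (intro mahavier_subset_cover_power) simp
      show "f ` orbits G n x \<subseteq> mahavier X G n"
      proof
        fix w assume "w \<in> f ` orbits G n x"
        then obtain xs where xs: "xs \<in> orbits G n x" "w = f xs" by blast
        have "(w (Suc i), w i) \<in> G" if "i < n" for i
          using orbits_step[OF xs(1), of "n - Suc i"] that
          by (simp add: xs(2) f_def Suc_diff_Suc)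
        moreover have "w \<in> {..<n+1} \<rightarrow>\<^sub>E X"
          unfolding xs(2) f_def using orbit_in_X[OF xs(1)] by (auto simp: PiE_iff)
        ultimately show "w \<in> mahavier X G n" unfolding mahavier_def by blast
      qed
      fix xs ys C
      assume xs: "xs \<in> orbits G n x" and ys: "ys \<in> orbits G n x"
        and C: "C \<in> cover_power \<alpha> (n + 1)" "f xs \<in> C" "f ys \<in> C"
      obtain A where A: "A \<in> {..<n+1} \<rightarrow> \<alpha>" "C = Pi\<^sub>E {..<n+1} A"
        using C(1) unfolding cover_power_def by blast
      show "xs = ys"
      proof (rule orbits_eq_if_close[OF branch xs ys])
        fix i assume i: "i \<le> n"
        hence "f xs (n - i) \<in> A (n - i)" "f ys (n - i) \<in> A (n - i)" "A (n - i) \<in> \<alpha>"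
          using A C by (auto simp: PiE_iff Pi_iff)
        hence "dist (f xs (n - i)) (f ys (n - i)) < \<delta>" using small by blast
        thus "dist (xs ! i) (ys ! i) < \<delta>" using i by (simp add: f_def less_Suc_eq_le)
      qed
    qed
  qed
  have "ln 2 / real K \<le> entropy_cover X G \<alpha>"
  proof (rule LIMSEQ_le_const)
    have "(\<lambda>m. 1 / real m * ln (real (N m))) \<longlonglongrightarrow> entropy_cover X G \<alpha>"
      unfolding N_def using fin cov by (intro entropy_cover_LIMSEQ) auto
    moreover have "strict_mono (\<lambda>m. m * K)" using K by (intro strict_monoI) simp
    ultimately show "(\<lambda>m. 1 / real (m * K) * ln (real (N (m * K)))) \<longlonglongrightarrow> entropy_cover X G \<alpha>"
      using LIMSEQ_subseq_LIMSEQ by (fastforce simp: o_def)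
    have "ln 2 / real K \<le> 1 / real (m * K) * ln (real (N (m * K)))" if m: "1 \<le> m" for m
    proof -
      have "2 ^ m \<le> N (m * K)" using growth N le_trans by blast
      hence le: "2 ^ m \<le> real (N (m * K))"
        by (metis of_nat_le_iff of_nat_numeral of_nat_power)
      have "real m * ln 2 = ln (2 ^ m)" by (simp add: ln_realpow)
      also have "\<dots> \<le> ln (real (N (m * K)))"
        by (rule ln_mono) (use le in \<open>auto intro: less_le_trans[rotated]\<close>)
      finally show ?thesis using m K by (simp add: field_simps)
    qed
    thus "\<exists>n0. \<forall>m\<ge>n0. ln 2 / real K \<le> 1 / real (m * K) * ln (real (N (m * K)))" by blast
  qed
  moreover have "0 < ln 2 / real K" using K by simp
  ultimately have "0 < ereal (entropy_cover X G \<alpha>)" by simp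
  also have "\<dots> \<le> (SUP \<alpha>\<in>{\<alpha>. open_cover X \<alpha>}. ereal (entropy_cover X G \<alpha>))"
    using \<open>open_cover X \<alpha>\<close> by (intro SUP_upper) simp
  finally have pos: "0 < (SUP \<alpha>\<in>{\<alpha>. open_cover X \<alpha>}. ereal (entropy_cover X G \<alpha>))" .
  have "G \<noteq> {}"
  proof
    assume "G = {}"
    hence "orbits G (1 * K) x = {}" using K by (cases K) auto
    thus False using growth[of 1] by simp
  qed
  thus ?thesis unfolding relation_entropy_def using pos by simp
qed

section \<open>Closed relations as set-valued functions\<close>

text \<open>
  Upper semicontinuity is the tube lemma: the points \<open>x\<close> whose fibre leaves an open set form the
  projection of a compact part of \<open>H\<close>, hence a closed set.
\<close>

lemma compact_relation_is_usc_graph: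
  fixes X :: "'a::metric_space set" and Y :: "'b::metric_space set"
  assumes H: "compact H" "H \<subseteq> X \<times> Y" and dom: "fst ` H = X" and ran: "snd ` H = Y"
  shows "\<exists>F. set_valued_function X Y F \<and> svf_surjective X Y F \<and>
    upper_semicontinuous X Y F \<and> H = svf_graph X Y F"
proof (intro exI conjI)
  have closed: "closed H" using H(1) by (rule compact_imp_closed)
  show "set_valued_function X Y (\<lambda>x. H `` {x})"
    unfolding set_valued_function_def nonempty_closed_subsets_def
  proof (intro Pi_I CollectI conjI)
    fix x assume "x \<in> X"
    show "H `` {x} \<noteq> {}" using \<open>x \<in> X\<close> dom by force
    have "closed (Pair x -` H)" by (rule closed_vimage[OF closed]) (intro continuous_intros)
    moreover have "H `` {x} = Y \<inter> (Pair x -` H)" using H(2) by auto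
    ultimately show "closedin (top_of_set Y) (H `` {x})" by (simp add: closedin_closed_Int)
  qed
  show "svf_surjective X Y (\<lambda>x. H `` {x})"
    unfolding svf_surjective_def using H(2) ran by force
  show "H = svf_graph X Y (\<lambda>x. H `` {x})" unfolding svf_graph_def using H(2) by auto
  show "upper_semicontinuous X Y (\<lambda>x. H `` {x})"
    unfolding upper_semicontinuous_def
  proof (intro ballI allI impI)
    fix x U assume x: "x \<in> X" and U: "openin (top_of_set Y) U \<and> H `` {x} \<subseteq> U"
    obtain T where T: "open T" "U = Y \<inter> T" using U by (auto simp: openin_open)
    define B where "B = fst ` (H \<inter> snd -` (- T))"
    have "closed (snd -` (- T) :: ('a \<times> 'b) set)"
      using T(1) by (intro closed_vimage continuous_intros) auto
    hence "compact (H \<inter> snd -` (- T))" using H(1) by blast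
    hence "compact B" unfolding B_def
      by (intro compact_continuous_image continuous_intros)
    hence "open (- B)" using compact_imp_closed by auto
    hence "openin (top_of_set X) (X \<inter> - B)" by (rule openin_open_Int)
    moreover have "x \<in> X \<inter> - B" using x U T(2) unfolding B_def by auto
    moreover have "\<forall>v\<in>X \<inter> - B. H `` {v} \<subseteq> U" using H(2) T(2) unfolding B_def by force
    ultimately show "\<exists>V. openin (top_of_set X) V \<and> x \<in> V \<and> (\<forall>v\<in>V. H `` {v} \<subseteq> U)" by blast
  qed
qed

section \<open>Two scalings about a common fixed point\<close>

text \<open>
  The relation on \<open>[0, 1]\<close> that becomes multiplication by \<open>s\<close> or \<open>t\<close> within \<open>[1, 2]\<close> in the coordinate
  \<open>1 + x\<close>; the common fixed point of both maps is \<open>x = -1\<close>.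
\<close>

definition scaling_relation :: "real \<Rightarrow> real \<Rightarrow> (real \<times> real) set" where
  "scaling_relation s t =
     {(x, y) \<in> {0..1} \<times> {0..1}. 1 + y = s * (1 + x) \<or> 1 + y = t * (1 + x)}"

lemma compact_scaling_relation: "compact (scaling_relation s t)"
proof -
  have "closed ({p. 1 + snd p = s * (1 + fst p)} \<union> {p. 1 + snd p = t * (1 + fst p)} :: (real \<times> real) set)"
    by (intro closed_Un closed_Collect_eq continuous_intros)
  moreover have "scaling_relation s t = ({0..1} \<times> {0..1}) \<inter>
      ({p. 1 + snd p = s * (1 + fst p)} \<union> {p. 1 + snd p = t * (1 + fst p)})"
    unfolding scaling_relation_def by auto
  ultimately show ?thesis by (simp add: compact_Int_closed compact_Times)
qed

text \<open>
  Both branches are available on the window \<open>1/t \<le> 1 + x \<le> 2/s\<close>. The assumption \<open>s < 2 t\<^sup>2\<close> says that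
  the window is, multiplicatively, wider than one step by \<open>t\<close>; with \<open>s t < 1\<close> it is also wider than one step
  by \<open>s\<close>. So orbits cannot jump over the window in either direction.
\<close>

locale expanding_contracting =
  fixes s t :: real
  assumes expand: "1 < s" and contract: "t < 1" and t_pos: "0 < t"
    and prod_less_1: "s * t < 1" and wide_overlap: "s < 2 * t\<^sup>2"
begin

abbreviation "H \<equiv> scaling_relation s t"

text \<open>The window and its complement are described below by the inequalities
  \<open>s * (1 + x) \<le> 2\<close> (the step up stays in \<open>[0, 1]\<close>) and \<open>1 \<le> t * (1 + x)\<close> (the step down does).\<close>

lemma up_step: "0 \<le> x \<Longrightarrow> s * (1 + x) \<le> 2 \<Longrightarrow> (x, s * (1 + x) - 1) \<in> H"
proof -
  assume x: "0 \<le> x" "s * (1 + x) \<le> 2"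
  have "1 + x \<le> s * (1 + x)" using x(1) expand by simp
  hence "x \<le> 1" "0 \<le> s * (1 + x) - 1" using x by linarith+
  thus ?thesis using x unfolding scaling_relation_def by simp
qed

lemma down_step: "x \<le> 1 \<Longrightarrow> 1 \<le> t * (1 + x) \<Longrightarrow> (x, t * (1 + x) - 1) \<in> H"
proof -
  assume x: "x \<le> 1" "1 \<le> t * (1 + x)"
  have pos: "0 < 1 + x" by (rule zero_less_mult_pos[OF _ t_pos]) (use x in linarith)
  hence "t * (1 + x) < 1 + x" using contract by simp
  hence "0 \<le> x" "t * (1 + x) - 1 \<le> 1" using x by linarith+
  thus ?thesis using x unfolding scaling_relation_def by simp
qed

lemma finite_successors: "finite (H `` {x})"
proof -
  have "H `` {x} \<subseteq> {s * (1 + x) - 1, t * (1 + x) - 1}"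
    unfolding scaling_relation_def by auto
  thus ?thesis by (rule finite_subset) simp
qed

lemma successors_separated:
  assumes "(x, y) \<in> H" "(x, z) \<in> H" "y \<noteq> z"
  shows "s - t \<le> dist y z"
proof -
  have x: "0 \<le> x" using assms(1) unfolding scaling_relation_def by auto
  have "(s - t) * 1 \<le> (s - t) * (1 + x)"
    by (rule mult_left_mono) (use x expand contract in auto)
  hence "s - t \<le> s * (1 + x) - t * (1 + x)" by (simp add: algebra_simps)
  moreover have "(1 + y = s * (1 + x) \<and> 1 + z = t * (1 + x)) \<or>
      (1 + z = s * (1 + x) \<and> 1 + y = t * (1 + x))"
    using assms unfolding scaling_relation_def by auto
  ultimately show ?thesis unfolding dist_real_def by argo
qed

text \<open>From above the window even two steps down are possible; so the first of them does not fall
  below the window.\<close>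

lemma above_overlap: "s * (1 + x) > 2 \<Longrightarrow> 1 \<le> t\<^sup>2 * (1 + x)"
proof -
  assume "s * (1 + x) > 2"
  hence "0 < s * (1 + x)" by simp
  hence "0 < 1 + x" by (rule zero_less_mult_pos) (use expand in simp)
  hence "s * (1 + x) < 2 * t\<^sup>2 * (1 + x)" using wide_overlap by simp
  thus ?thesis using \<open>s * (1 + x) > 2\<close> by simp
qed

text \<open>From below the window even two steps up are possible: as \<open>s\<^sup>2 t\<^sup>2 \<cdot> (1 + x) < s \<cdot> (s t) < s < 2 t\<^sup>2\<close>.
  So the first of them does not rise above the window.\<close>

lemma below_overlap: "t * (1 + x) < 1 \<Longrightarrow> s * (s * (1 + x)) \<le> 2"
proof -
  assume x: "t * (1 + x) < 1"
  have "(s * t) * (s * (t * (1 + x))) \<le> 1 * (s * 1)"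
  proof (cases "0 \<le> 1 + x")
    case True thus ?thesis
      using x expand t_pos prod_less_1 by (intro mult_mono) auto
  next
    case False
    hence "(s * t) * (s * (t * (1 + x))) \<le> 0"
      using expand t_pos by (simp add: mult_nonneg_nonpos)
    thus ?thesis using expand by linarith
  qed
  hence "t\<^sup>2 * (s * (s * (1 + x))) < 2 * t\<^sup>2"
    using wide_overlap by (simp add: power2_eq_square algebra_simps)
  thus ?thesis using t_pos by (simp add: mult.commute)
qed

lemma domain_H: "fst ` H = {0..1}"
proof
  show "fst ` H \<subseteq> {0..1}" unfolding scaling_relation_def by auto
  show "{0..1} \<subseteq> fst ` H"
  proof
    fix x :: real assume x: "x \<in> {0..1}"
    show "x \<in> fst ` H"
    proof (cases "s * (1 + x) \<le> 2")
      case True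
      thus ?thesis using up_step[of x] x by force
    next
      case False
      hence "1 \<le> t\<^sup>2 * (1 + x)" using above_overlap by simp
      also have "\<dots> \<le> t * (1 + x)"
        using x t_pos contract by (intro mult_right_mono) (auto simp: power2_eq_square)
      finally show ?thesis using down_step[of x] x by force
    qed
  qed
qed

lemma range_H: "snd ` H = {0..1}"
proof
  show "snd ` H \<subseteq> {0..1}" unfolding scaling_relation_def by auto
  show "{0..1} \<subseteq> snd ` H"
  proof
    fix y :: real assume y: "y \<in> {0..1}"
    show "y \<in> snd ` H"
    proof (cases "s \<le> 1 + y")
      case True
      have "1 + y \<le> s * (1 + y)" using y expand by simp
      hence "(1 + y) / s \<le> 1 + y" using expand by (simp add: divide_le_eq mult.commute)
      moreover have "1 \<le> (1 + y) / s" using True expand by simp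
      moreover have "1 + y = s * (1 + ((1 + y) / s - 1))" using expand by simp
      ultimately have "((1 + y) / s - 1, y) \<in> H"
        using y unfolding scaling_relation_def by simp
      thus ?thesis by force
    next
      case False
      have "t\<^sup>2 < t" using t_pos contract by (simp add: power2_eq_square)
      hence "1 + y \<le> 2 * t" using False wide_overlap by linarith
      moreover have "t \<le> 1 + y" using y contract by auto
      ultimately have "1 \<le> (1 + y) / t" "(1 + y) / t \<le> 2"
        using t_pos by (simp_all add: divide_le_eq)
      moreover have "1 + y = t * (1 + ((1 + y) / t - 1))" using t_pos by simp
      ultimately have "((1 + y) / t - 1, y) \<in> H"
        using y unfolding scaling_relation_def by simp
      thus ?thesis by force
    qed
  qed
qed

lemma card_orbits_H: "card (orbits H (Suc n) x) = (\<Sum>y\<in>H `` {x}. card (orbits H n y))"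
  by (rule card_orbits_Suc) (rule finite_successors)

lemma card_orbits_le_Suc: "(x, y) \<in> H \<Longrightarrow> card (orbits H n y) \<le> card (orbits H (Suc n) x)"
  unfolding card_orbits_H
  by (rule member_le_sum[where f = "\<lambda>y. card (orbits H n y)"])
    (simp_all add: finite_successors)

text \<open>Every point has a successor, so a uniform lower bound on the number of orbits is inherited
  by longer orbits.\<close>

lemma card_orbits_ge_mono:
  assumes "\<And>x. x \<in> {0..1} \<Longrightarrow> C \<le> card (orbits H n x)"
  shows "x \<in> {0..1} \<Longrightarrow> C \<le> card (orbits H (n + j) x)"
proof (induction j arbitrary: x)
  case (Suc j)
  then obtain y where y: "(x, y) \<in> H" using domain_H by (metis fst_conv imageE surj_pair)
  hence "y \<in> {0..1}" unfolding scaling_relation_def by auto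
  hence "C \<le> card (orbits H (n + j) y)" by (rule Suc.IH)
  also have "\<dots> \<le> card (orbits H (Suc (n + j)) x)" by (rule card_orbits_le_Suc[OF y])
  finally show ?case by simp
qed (use assms in auto)

lemma card_orbits_overlap:
  assumes C: "\<And>x. x \<in> {0..1} \<Longrightarrow> C \<le> card (orbits H n x)"
    and x: "x \<in> {0..1}" "s * (1 + x) \<le> 2" "1 \<le> t * (1 + x)"
  shows "2 * C \<le> card (orbits H (Suc n) x)"
proof -
  define y where "y = s * (1 + x) - 1"
  define z where "z = t * (1 + x) - 1"
  have yz: "(x, y) \<in> H" "(x, z) \<in> H"
    using up_step[of x] down_step[of x] x unfolding y_def z_def by auto
  have "t * (1 + x) < s * (1 + x)"
    using x(1) expand contract by (intro mult_strict_right_mono) auto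
  hence "y \<noteq> z" unfolding y_def z_def by linarith
  have "y \<in> {0..1}" "z \<in> {0..1}" using yz unfolding scaling_relation_def by auto
  hence "2 * C \<le> card (orbits H n y) + card (orbits H n z)"
    using C[of y] C[of z] by linarith
  also have "\<dots> = (\<Sum>w\<in>{y, z}. card (orbits H n w))" using \<open>y \<noteq> z\<close> by simp
  also have "\<dots> \<le> (\<Sum>w\<in>H `` {x}. card (orbits H n w))"
    by (rule sum_mono2) (use yz finite_successors in auto)
  finally show ?thesis unfolding card_orbits_H .
qed

text \<open>A point that reaches height \<open>1/t\<close> within \<open>j\<close> steps up meets the window on its way, because it
  never passes \<open>2/s\<close> before; there the number of orbits doubles. Steps left over are filled in
  by \<open>card_orbits_ge_mono\<close>.\<close>

lemma card_orbits_climb: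
  assumes C: "\<And>x. x \<in> {0..1} \<Longrightarrow> C \<le> card (orbits H n x)"
  shows "x \<in> {0..1} \<Longrightarrow> s * (1 + x) \<le> 2 \<Longrightarrow> 1 \<le> t * (s ^ j * (1 + x)) \<Longrightarrow>
    2 * C \<le> card (orbits H (Suc (n + j)) x)"
proof (induction j arbitrary: x)
  case 0
  thus ?case using card_orbits_overlap[OF C] by simp
next
  case (Suc j)
  show ?case
  proof (cases "1 \<le> t * (1 + x)")
    case True
    show ?thesis
    proof (rule card_orbits_overlap)
      show "C \<le> card (orbits H (n + Suc j) y)" if "y \<in> {0..1}" for y
        using C that by (rule card_orbits_ge_mono)
    qed (use True Suc.prems in auto)
  next
    case False
    define y where "y = s * (1 + x) - 1"
    have y: "(x, y) \<in> H" unfolding y_def using up_step Suc.prems by simp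
    hence "y \<in> {0..1}" unfolding scaling_relation_def by auto
    moreover have "s * (1 + y) \<le> 2" using below_overlap[of x] False by (simp add: y_def)
    moreover have "1 \<le> t * (s ^ j * (1 + y))" using Suc.prems(3) by (simp add: y_def mult_ac)
    ultimately have "2 * C \<le> card (orbits H (Suc (n + j)) y)" by (rule Suc.IH)
    thus ?thesis using card_orbits_le_Suc[OF y, of "Suc (n + j)"] by simp
  qed
qed

text \<open>
  The uniform return time to the window: \<open>k\<close> steps up with \<open>s\<^sup>k > 1/t\<close> suffice from below, as
  \<open>1 + x \<ge> 1\<close>, and one step down suffices from above. \<open>K\<close> leaves room for the branching step itself.
\<close>

lemma orbits_double:
  obtains K where "0 < K"
    "\<And>C n x. (\<And>x. x \<in> {0..1} \<Longrightarrow> C \<le> card (orbits H n x)) \<Longrightarrow> x \<in> {0..1} \<Longrightarrow>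
      2 * C \<le> card (orbits H (K + n) x)"
proof -
  obtain k where k: "1 / t < s ^ k" using real_arch_pow[OF expand] by blast
  have "2 * C \<le> card (orbits H (k + 2 + n) x)"
    if C: "\<And>x. x \<in> {0..1} \<Longrightarrow> C \<le> card (orbits H n x)" and x: "x \<in> {0..1}" for C n x
  proof (cases "s * (1 + x) \<le> 2")
    case True
    have "1 \<le> t * s ^ k" using k t_pos by (simp add: field_simps)
    hence "1 * 1 \<le> t * s ^ k * (1 + x)" using x by (intro mult_mono) auto
    hence "2 * C \<le> card (orbits H (Suc (n + 1 + k)) x)"
      using x True by (intro card_orbits_climb card_orbits_ge_mono C) (auto simp: mult_ac)
    thus ?thesis by (simp add: add_ac)
  next
    case False
    define y where "y = t * (1 + x) - 1"
    have big: "1 \<le> t\<^sup>2 * (1 + x)" using above_overlap False by simp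
    also have "\<dots> \<le> t * (1 + x)"
      using x t_pos contract by (intro mult_right_mono) (auto simp: power2_eq_square)
    finally have y: "(x, y) \<in> H" unfolding y_def using down_step x by simp
    hence y01: "y \<in> {0..1}" unfolding scaling_relation_def by auto
    have "(s * t) * (1 + x) \<le> 1 * 2"
      using x prod_less_1 expand t_pos by (intro mult_mono) auto
    hence "s * (1 + y) \<le> 2" by (simp add: y_def mult_ac)
    moreover have "1 \<le> t * (1 + y)" using big by (simp add: y_def power2_eq_square mult_ac)
    ultimately have "2 * C \<le> card (orbits H (Suc (n + k)) y)"
      using y01 by (intro card_orbits_overlap card_orbits_ge_mono C) auto
    also have "\<dots> \<le> card (orbits H (Suc (Suc (n + k))) x)"
      by (rule card_orbits_le_Suc[OF y])
    finally show ?thesis by (simp add: add_ac)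
  qed
  thus ?thesis using that[of "k + 2"] by simp
qed

lemma entropy_pos: "0 < relation_entropy {0..1} H"
proof -
  obtain K where K: "0 < K" and double: "\<And>C n x.
      (\<And>x. x \<in> {0..1} \<Longrightarrow> C \<le> card (orbits H n x)) \<Longrightarrow> x \<in> {0..1} \<Longrightarrow>
      2 * C \<le> card (orbits H (K + n) x)"
    using orbits_double by blast
  have growth: "x \<in> {0..1} \<Longrightarrow> 2 ^ m \<le> card (orbits H (m * K) x)" for m x
  proof (induction m arbitrary: x)
    case (Suc m)
    show ?case using double[of "2 ^ m" "m * K" x] Suc by simp
  qed simp
  show ?thesis
  proof (rule relation_entropy_pos_if_branching)
    show "H \<subseteq> {0..1} \<times> {0..1}" unfolding scaling_relation_def by auto
    show "(0::real) \<in> {0..1}" by simp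
    show "0 < s - t" using expand contract by simp
    show "0 < K" by (rule K)
    show "2 ^ m \<le> card (orbits H (m * K) 0)" for m by (rule growth) simp
  qed (auto simp: successors_separated)
qed

end

text \<open>
  Going back along a sequence multiplies \<open>1 + x\<close> by a word in \<open>s\<close> and \<open>t\<close>; since the
  factors commute, only the number of each letter matters. Over a period the product is \<open>1\<close>.
\<close>

lemma scaling_relation_no_periodic_point:
  assumes s: "\<And>k::nat. k > 0 \<Longrightarrow> s ^ k \<notin> \<rat>" and t: "t \<in> \<rat>" "0 < t" "t < 1"
  shows "\<not> periodic_point_generated {0..1} (scaling_relation s t) x"
proof
  assume "periodic_point_generated {0..1} (scaling_relation s t) x"
  then obtain n where x: "\<And>i. (x (Suc i), x i) \<in> scaling_relation s t"
    and n: "n > 0" "(shift_map ^^ n) x = x"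
    unfolding periodic_point_generated_def mahavier_inf_def by blast
  have word: "\<exists>i j. i + j = m \<and> 1 + x 0 = s ^ i * t ^ j * (1 + x m)" for m
  proof (induction m)
    case (Suc m)
    then obtain i j where ij: "i + j = m" "1 + x 0 = s ^ i * t ^ j * (1 + x m)" by blast
    have "1 + x m = s * (1 + x (Suc m)) \<or> 1 + x m = t * (1 + x (Suc m))"
      using x[of m] unfolding scaling_relation_def by auto
    thus ?case
    proof
      assume "1 + x m = s * (1 + x (Suc m))"
      hence "Suc i + j = Suc m \<and> 1 + x 0 = s ^ Suc i * t ^ j * (1 + x (Suc m))"
        using ij by (simp add: mult_ac)
      thus ?case by blast
    next
      assume "1 + x m = t * (1 + x (Suc m))"
      hence "i + Suc j = Suc m \<and> 1 + x 0 = s ^ i * t ^ Suc j * (1 + x (Suc m))"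
        using ij by (simp add: mult_ac)
      thus ?case by blast
    qed
  qed simp
  have shift: "(shift_map ^^ m) x i = x (i + m)" for m i
    by (induction m arbitrary: i) (auto simp: shift_map_def)
  have "x n = x 0" using shift[of n 0] n(2) by simp
  moreover have "0 \<le> x 0" using x[of 0] unfolding scaling_relation_def by auto
  ultimately obtain i j where ij: "i + j = n" "s ^ i * t ^ j = 1" using word[of n] by auto
  show False
  proof (cases "i = 0")
    case True
    hence "t ^ j < 1" using ij(1) n(1) t by (simp add: power_less_one_iff)
    thus False using ij(2) True by simp
  next
    case False
    have "s ^ i = inverse (t ^ j)" using ij(2) t(2) by (simp add: field_simps)
    thus False using s[of i] False t(1) by auto
  qed
qed

theorem theorem7p12:
  fixes a b :: real and H :: "(real \<times> real) set"
  assumes "1 < a" and "a < sqrt 2"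
    and "\<And>k::nat. k > 0 \<Longrightarrow> (2 * a / (1 + a)) ^ k \<notin> \<rat>"
    and "b \<in> \<rat>" and "a / (a + 1) < b" and "b < 1 / a"
    and "H = {(x, y) \<in> {0..1 / a} \<times> {0..1}. y = 2 * a / (a + 1) * x + (a - 1) / (a + 1)}
           \<union> {(x, y) \<in> {0..1} \<times> {0..b}. y = (b + 1) / 2 * x + (b - 1) / 2}"
  shows "(\<exists>F. set_valued_function {0..1} {0..1} F \<and> svf_surjective {0..1} {0..1} F \<and>
              upper_semicontinuous {0..1} {0..1} F \<and> H = svf_graph {0..1} {0..1} F)
         \<and> i_embedded {0..1} H"
proof -
  define s where "s = 2 * a / (a + 1)"
  define t where "t = (b + 1) / 2"
  have a: "1 < a" by fact
  have "0 < a / (a + 1)" using a by simp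
  hence b0: "0 < b" using assms(5) by linarith
  have "1 / a < 1" using a by simp
  hence b1: "b < 1" using assms(6) by linarith
  interpret expanding_contracting s t
  proof
    show "1 < s" unfolding s_def using a by (simp add: field_simps)
    show "t < 1" "0 < t" unfolding t_def using b0 b1 by auto
    have "b * a < 1" using assms(6) a by (simp add: field_simps)
    thus "s * t < 1" unfolding s_def t_def using a by (simp add: field_simps)
    \<comment> \<open>With \<open>e = 1/(a+1)\<close> one has \<open>s = 2 (1 - e)\<close> and \<open>t > 1 - e/2\<close>, whose square exceeds \<open>1 - e\<close>.\<close>
    define e where "e = 1 / (a + 1)"
    have e: "a / (a + 1) = 1 - e" "0 < e" "e < 1"
      unfolding e_def using a by (simp_all add: field_simps)
    have "1 - e / 2 < t" unfolding t_def using assms(5) e(1) by simp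
    hence "(1 - e / 2)\<^sup>2 < t\<^sup>2" using e by (intro power_strict_mono) auto
    moreover have "2 * (1 - e / 2)\<^sup>2 = 2 * (1 - e) + e\<^sup>2 / 2"
      by (simp add: power2_eq_square field_simps)
    moreover have "s = 2 * (1 - e)" unfolding s_def e(1)[symmetric] by simp
    moreover have "0 \<le> e\<^sup>2" by simp
    ultimately show "s < 2 * t\<^sup>2" by linarith
  qed
  have up: "y = 2 * a / (a + 1) * x + (a - 1) / (a + 1) \<longleftrightarrow> 1 + y = s * (1 + x)" for x y
  proof -
    have "(a - 1) / (a + 1) = s - 1" unfolding s_def using a by (simp add: field_simps)
    thus ?thesis unfolding s_def[symmetric] by (auto simp: algebra_simps)
  qed
  have down: "y = (b + 1) / 2 * x + (b - 1) / 2 \<longleftrightarrow> 1 + y = t * (1 + x)" for x y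
    unfolding t_def by (auto simp: field_simps)
  have up_dom: "x \<le> 1 / a \<longleftrightarrow> y \<le> 1" if "1 + y = s * (1 + x)" for x y
  proof -
    have "y \<le> 1 \<longleftrightarrow> s * (1 + x) \<le> 2" using that by linarith
    also have "\<dots> \<longleftrightarrow> x \<le> 1 / a" unfolding s_def using a by (simp add: field_simps)
    finally show ?thesis by simp
  qed
  have down_ran: "x \<le> 1 \<longleftrightarrow> y \<le> b" if "1 + y = t * (1 + x)" for x y
  proof -
    have "y \<le> b \<longleftrightarrow> t * (1 + x) \<le> t * 2" using that by (simp add: t_def) linarith
    thus ?thesis using t_pos by simp
  qed
  have "H = scaling_relation s t"
    unfolding assms(7) scaling_relation_def up down
    using up_dom down_ran \<open>1 / a < 1\<close> b1 by fastforce
  moreover have "\<not> periodic_point_generated {0..1} (scaling_relation s t) x" for x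
  proof (rule scaling_relation_no_periodic_point)
    show "s ^ k \<notin> \<rat>" if "k > 0" for k :: nat
      using assms(3)[OF that] by (simp add: s_def add.commute)
    show "t \<in> \<rat>" unfolding t_def using assms(4) by simp
  qed (use t_pos contract in auto)
  moreover have sub: "scaling_relation s t \<subseteq> {0..1} \<times> {0..1}"
    unfolding scaling_relation_def by auto
  moreover have "closed_relation {0..1} (scaling_relation s t)"
    unfolding closed_relation_def
    using sub compact_imp_closed[OF compact_scaling_relation] by (rule closed_subset)
  ultimately show ?thesis
    using compact_relation_is_usc_graph[OF compact_scaling_relation _ domain_H range_H] entropy_pos
    unfolding i_embedded_def by simp
qed

end
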